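(* Let $(E,\sigma,\beta)$ be a cyclic algebra of degree $3$ over $\mathbb{Q}$. Then $(E,\sigma,\beta)\cong M_3(\mathbb{Q})$ if and only if there exists $x\in E$ such that $$x\,\sigma(x)\,\sigma^2(x)=\frac{1}{\beta}.$$
   Context: A $\mathbb{Q}$-algebra $A$ is a cyclic algebra of degree $3$ if there are elements $a,b\in A$ such that $A=\langle 1,a,a^2,b,ab,a^2b,b^2,ab^2,a^2b^2\rangle_{\mathbb{Q}}$ (the $\mathbb{Q}$-linear span) and: (i) $E=\langle 1,a,a^2\rangle_{\mathbb{Q}}$ is a (cubic) Galois field extension of $\mathbb{Q}$ with $\mathrm{Gal}(E|\mathbb{Q})=\langle\sigma\rangle$; (ii) $ba=\sigma(a)b$; (iii) $b^3=\beta 1$, where $\beta\in\mathbb{Q}^*$. In this case one writes $A=(E,\sigma,\beta)$. *)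

theory Defs
  imports
    "HOL-Analysis.Finite_Cartesian_Product"
    "HOL-Algebra.Bij"
    "HOL-Algebra.Generated_Groups"
    "HOL-Algebra.Algebraic_Closure_Type"
begin

unbundle no fps_syntax

text \<open>The algebra is the whole type \<open>'a\<close>; its scalar multiplication is explicit, in the style of
  the vector space library.\<close>

locale unital_algebra = Vector_Spaces.vector_space scale
  for scale :: "'k::Fields.field \<Rightarrow> 'a::Rings.ring_1 \<Rightarrow> 'a" +
  assumes scale_mult_left: "scale c x * y = scale c (x * y)"
    and scale_mult_right: "x * scale c y = scale c (x * y)"
begin

definition base_field :: "'a set" where
  "base_field = range (\<lambda>c. scale c 1)"

text \<open>As for \<^const>\<open>BijGroup\<close>, the elements are extensional functions on \<open>E\<close>.\<close>

definition gal_group :: "'a set \<Rightarrow> ('a \<Rightarrow> 'a) monoid" where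
  "gal_group E = (BijGroup E)
     \<lparr>carrier := {\<tau> \<in> Bij E.
        \<tau> \<in> ring_hom (ring_of_type_algebra\<lparr>carrier := E\<rparr>) (ring_of_type_algebra\<lparr>carrier := E\<rparr>) \<and>
        (\<forall>x\<in>base_field. \<tau> x = x)}\<rparr>"

text \<open>Finite Galois extensions of the base field inside the (possibly noncommutative) algebra;
  Galois means that the base field is the fixed field of the automorphism group.\<close>

definition galois_extension :: "'a set \<Rightarrow> bool" where
  "galois_extension E \<longleftrightarrow>
     subfield E ring_of_type_algebra \<and> base_field \<subseteq> E \<and>
     (\<exists>B. finite B \<and> span B = E) \<and>
     {x \<in> E. \<forall>\<tau>\<in>carrier (gal_group E). \<tau> x = x} = base_field"

definition cyclic_algebra_deg3 :: "'a set \<Rightarrow> ('a \<Rightarrow> 'a) \<Rightarrow> 'k \<Rightarrow> bool" where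
  "cyclic_algebra_deg3 E \<sigma> \<beta> \<longleftrightarrow>
     (\<exists>a b.
        span {1, a, a^2, b, a * b, a^2 * b, b^2, a * b^2, a^2 * b^2} = UNIV \<and>
        E = span {1, a, a^2} \<and> galois_extension E \<and> dim E = 3 \<and>
        carrier (gal_group E) = generate (gal_group E) {\<sigma>} \<and>
        b * a = \<sigma> a * b \<and>
        \<beta> \<noteq> 0 \<and> b^3 = scale \<beta> 1)"

text \<open>The matrix product is \<open>**\<close>; the instance of \<open>*\<close> for \<open>'k^'n^'n\<close> is componentwise.\<close>

definition matrix_algebra_iso :: "('a \<Rightarrow> 'k^'n^'n) \<Rightarrow> bool" where
  "matrix_algebra_iso f \<longleftrightarrow>
     Vector_Spaces.linear scale (\<lambda>c M. \<chi> i j. c * M $ i $ j) f \<and> bij f \<and>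
     (\<forall>x y. f (x * y) = f x ** f y) \<and> f 1 = mat 1"

end

end

theory Submission
  imports Defs "HOL-Analysis.Cartesian_Space"
begin

text \<open>
  Write \<open>A = E \<oplus> E b \<oplus> E b\<^sup>2\<close> with \<open>b e = \<sigma>(e) b\<close> and \<open>b\<^sup>3 = \<beta>\<close>, and let
  \<open>N(x) = x \<sigma>(x) \<sigma>\<^sup>2(x)\<close>. The argument works over an arbitrary base field \<open>k\<close>; it compares
  three-dimensional modules over \<open>A\<close> with \<open>E\<close>.

  If \<open>A\<close> is isomorphic to \<open>M\<^sub>3(k)\<close>, it acts on \<open>k\<^sup>3\<close>. For a nonzero vector \<open>v\<close> the map
  \<open>e \<mapsto> e v\<close> is injective on the field \<open>E\<close>, hence a bijection between the three-dimensional spaces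
  \<open>E\<close> and \<open>k\<^sup>3\<close>. So \<open>b v = z v\<close> for some \<open>z \<in> E\<close>, and moving \<open>b\<close> past elements of \<open>E\<close> gives
  \<open>\<beta> v = b\<^sup>3 v = N(z) v\<close>. Thus \<open>N(z) = \<beta>\<close>, and \<open>x = 1 / z\<close> is a solution
  (\<open>norm_eq_inverse_if_matrix_algebra_iso\<close>).

  Conversely, if \<open>N(x) = 1 / \<beta>\<close>, then \<open>c = x b\<close> satisfies \<open>c\<^sup>3 = 1\<close>, so \<open>p = 1 + c + c\<^sup>2\<close> is fixed
  by left multiplication by \<open>c\<close>, and the left ideal \<open>A p\<close> collapses to \<open>E p\<close>, a space of dimension
  three. Left multiplication on it is a homomorphism from \<open>A\<close> to \<open>M\<^sub>3(k)\<close>. It is injective because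
  the two-sided ideal generated by \<open>p\<close> contains a nonzero element of \<open>E\<close>
  (\<open>eq_0_if_annihilates_E_p\<close>), and surjective because the coordinates with respect to
  \<open>a\<^sup>i b\<^sup>j\<close> embed \<open>M\<^sub>3(k)\<close> back into the finite-dimensional space \<open>A\<close>
  (\<open>surj_left_mult_matrix\<close>).

  The converse rests on the independence of \<open>1, b, b\<^sup>2\<close> over \<open>E\<close> (\<open>components_eq_0\<close>), which follows
  from the fact that \<open>a\<close>, \<open>\<sigma>(a)\<close> and \<open>\<sigma>\<^sup>2(a)\<close> are distinct.
\<close>

no_notation fps_nth (infixl \<open>$\<close> 75)

section \<open>The cubic field and the group generated by \<open>\<sigma>\<close>\<close>

text \<open>Otherwise \<open>u\<close> would be redundant, and two vectors would span a space of dimension three.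
  Permuting the triple shows that all three coefficients vanish.\<close>

lemma (in Vector_Spaces.vector_space) coeff_eq_0_if_dim_span_3:
  assumes "dim (span {u, v, w}) = 3" and "scale c u + scale d v + scale e w = 0"
  shows "c = 0"
proof (rule ccontr)
  assume c: "c \<noteq> 0"
  have "scale c u = - (scale d v + scale e w)"
    using assms(2) by (metis add.assoc eq_neg_iff_add_eq_0)
  then have "scale (inverse c) (scale c u) = scale (inverse c) (- (scale d v + scale e w))"
    by simp
  then have "u = scale (inverse c) (- (scale d v + scale e w))"
    using c by simp
  also have "\<dots> \<in> span {v, w}"
    by (intro span_scale span_neg span_add span_base) auto
  finally have "span {u, v, w} = span {v, w}"
    by (rule span_redundant)
  moreover have "dim (span {v, w}) \<le> card {v, w}"
    by (rule dim_le_card) auto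
  moreover have "card {v, w} \<le> 2"
    by (simp add: card_insert_if)
  ultimately show False
    using assms(1) by simp
qed

text \<open>Generators \<open>a\<close>, \<open>b\<close> are fixed once and for all, since the coordinates used below depend on
  them, while the criterion itself does not.\<close>

locale cyclic_algebra_generators = unital_algebra scale
  for scale :: "'k::Fields.field \<Rightarrow> 'a::Rings.ring_1 \<Rightarrow> 'a" +
  fixes E :: "'a set" and \<sigma> :: "'a \<Rightarrow> 'a" and \<beta> :: 'k and a b :: 'a
  assumes span_monomials:
      "span {1, a, a^2, b, a * b, a^2 * b, b^2, a * b^2, a^2 * b^2} = UNIV"
    and E_eq_span: "E = span {1, a, a^2}"
    and galois_E: "galois_extension E"
    and dim_E: "dim E = 3"
    and carrier_gal_group: "carrier (gal_group E) = generate (gal_group E) {\<sigma>}"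
    and b_mult_a: "b * a = \<sigma> a * b"
    and beta_nonzero: "\<beta> \<noteq> 0"
    and b_cubed: "b^3 = scale \<beta> 1"
begin

lemma subfield_E: "subfield E ring_of_type_algebra"
  using galois_E by (simp add: galois_extension_def)

lemma subspace_E: "subspace E"
  by (simp add: E_eq_span)

lemma E_mult_commute: "x \<in> E \<Longrightarrow> y \<in> E \<Longrightarrow> x * y = y * x"
  using subcring.sub_m_comm[OF subdomain.axioms(1)[OF subfield.axioms(1)[OF subfield_E]]]
  by (simp add: ring_of_type_algebra_def)

lemma one_neq_zero: "(1::'a) \<noteq> 0"
  using subdomain.sub_one_not_zero[OF subfield.axioms(1)[OF subfield_E]]
  by (simp add: ring_of_type_algebra_def)

lemma E_mult_closed [intro]: "x \<in> E \<Longrightarrow> y \<in> E \<Longrightarrow> x * y \<in> E"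
proof -
  have "submonoid E ring_of_type_algebra"
    using subfield_E
    by (simp add: subfield_def subdomain_def subcring_def subring_def)
  then show "x \<in> E \<Longrightarrow> y \<in> E \<Longrightarrow> x * y \<in> E"
    using submonoid.m_closed by (fastforce simp: ring_of_type_algebra_def)
qed

lemma E_closed [intro]:
  shows "1 \<in> E" "a \<in> E" "0 \<in> E"
    and "x \<in> E \<Longrightarrow> y \<in> E \<Longrightarrow> x + y \<in> E"
    and "x \<in> E \<Longrightarrow> y \<in> E \<Longrightarrow> x - y \<in> E"
    and "x \<in> E \<Longrightarrow> scale r x \<in> E"
  using subspace_add[OF subspace_E] subspace_diff[OF subspace_E] subspace_scale[OF subspace_E]
    subspace_0[OF subspace_E]
  by (auto simp: E_eq_span intro: span_base)

lemma E_inverse: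
  assumes "x \<in> E" "x \<noteq> 0"
  obtains y where "y \<in> E" "x * y = 1" "y * x = 1"
proof -
  have "x \<in> Units (ring_of_type_algebra\<lparr>carrier := E\<rparr>)"
    using subfield.subfield_Units[OF subfield_E] assms by (simp add: ring_of_type_algebra_def)
  then show thesis
    using that by (auto simp: Units_def ring_of_type_algebra_def)
qed

lemma E_no_zero_divisors:
  assumes "x \<in> E" "x \<noteq> 0" "y * x = 0"
  shows "y = 0"
proof -
  from assms(1,2) obtain x' where x': "x * x' = 1"
    by (rule E_inverse)
  have "y = y * x * x'"
    by (simp add: mult.assoc x')
  with assms(3) show ?thesis
    by simp
qed

lemma sigma_in_carrier: "\<sigma> \<in> carrier (gal_group E)"
  unfolding carrier_gal_group by (rule generate.incl) simp

lemma sigma_closed [intro]: "x \<in> E \<Longrightarrow> \<sigma> x \<in> E"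
  using sigma_in_carrier Bij_imp_funcset by (auto simp: gal_group_def)

lemma sigma_add: "x \<in> E \<Longrightarrow> y \<in> E \<Longrightarrow> \<sigma> (x + y) = \<sigma> x + \<sigma> y"
  and sigma_mult: "x \<in> E \<Longrightarrow> y \<in> E \<Longrightarrow> \<sigma> (x * y) = \<sigma> x * \<sigma> y"
  and sigma_one: "\<sigma> 1 = 1"
  and sigma_scalar: "\<sigma> (scale r 1) = scale r 1"
  using sigma_in_carrier
  by (auto simp: gal_group_def ring_hom_def ring_of_type_algebra_def base_field_def)

lemma sigma_scale: "x \<in> E \<Longrightarrow> \<sigma> (scale r x) = scale r (\<sigma> x)"
  using sigma_mult[of "scale r 1" x] sigma_scalar[of r] by (auto simp: scale_mult_left)

lemma in_E_iff:
  "x \<in> E \<longleftrightarrow> (\<exists>r s t. x = scale r 1 + scale s a + scale t (a^2))"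
proof
  assume "x \<in> E"
  then show "\<exists>r s t. x = scale r 1 + scale s a + scale t (a^2)"
    unfolding E_eq_span span_breakdown_eq
    by (auto simp: diff_eq_eq add.assoc algebra_simps)
next
  assume "\<exists>r s t. x = scale r 1 + scale s a + scale t (a^2)"
  then show "x \<in> E"
    by (auto simp: power2_eq_square)
qed

lemma sigma_combination:
  "\<sigma> (scale r 1 + scale s a + scale t (a^2)) = scale r 1 + scale s (\<sigma> a) + scale t (\<sigma> (a * a))"
  by (simp add: sigma_add sigma_scale sigma_one E_closed E_mult_closed power2_eq_square)

text \<open>The relation with the generator \<open>a\<close> extends to \<open>E = k[a]\<close> because both sides are
  multiplicative and linear in \<open>e\<close>.\<close>

lemma b_mult:
  assumes "e \<in> E"
  shows "b * e = \<sigma> e * b"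
proof -
  have a2: "b * (a * a) = \<sigma> (a * a) * b"
    by (metis E_closed(2) b_mult_a mult.assoc sigma_mult)
  obtain r s t where e: "e = scale r 1 + scale s a + scale t (a^2)"
    using in_E_iff[THEN iffD1, OF assms] by blast
  show ?thesis
    unfolding e sigma_combination
    by (simp add: power2_eq_square distrib_left distrib_right scale_mult_left scale_mult_right
        b_mult_a a2)
qed

text \<open>Conjugation by \<open>b\<close> induces \<open>\<sigma>\<close> on \<open>E\<close>, and \<open>b\<^sup>3\<close> is a nonzero scalar, hence central and
  cancellable. So \<open>\<sigma>\<close> has order dividing three without any appeal to Galois theory.\<close>

lemma sigma_cubed:
  assumes "e \<in> E"
  shows "\<sigma> (\<sigma> (\<sigma> e)) = e"
proof -
  have "b^3 * e = \<sigma> (\<sigma> (\<sigma> e)) * b^3"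
    using assms by (simp add: power3_eq_cube mult.assoc b_mult sigma_closed)
      (simp add: b_mult sigma_closed flip: mult.assoc)
  then have "scale \<beta> e = scale \<beta> (\<sigma> (\<sigma> (\<sigma> e)))"
    by (simp add: b_cubed scale_mult_left scale_mult_right)
  then show ?thesis
    using beta_nonzero by simp
qed

text \<open>If \<open>\<sigma>\<close> fixed \<open>a\<close>, it would be the identity of \<open>E\<close>; the group that it generates would be
  trivial, and its fixed field \<open>E\<close> would have dimension one.\<close>

lemma sigma_a_neq: "\<sigma> a \<noteq> a"
proof
  assume fix_a: "\<sigma> a = a"
  let ?id = "\<lambda>x\<in>E. x"
  have "\<sigma> e = e" if "e \<in> E" for e
  proof -
    obtain r s t where e: "e = scale r 1 + scale s a + scale t (a^2)"
      using in_E_iff[THEN iffD1, OF \<open>e \<in> E\<close>] by blast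
    show ?thesis
      unfolding e sigma_combination
      by (simp add: E_closed sigma_mult fix_a power2_eq_square)
  qed
  then have sigma_id: "\<sigma> = ?id"
    using sigma_in_carrier Bij_imp_extensional[of \<sigma> E]
    by (auto simp: gal_group_def extensional_def fun_eq_iff)
  have one: "\<one>\<^bsub>gal_group E\<^esub> = ?id"
    by (simp add: gal_group_def BijGroup_def)
  have Bij: "\<tau> \<in> Bij E" if "\<tau> \<in> carrier (gal_group E)" for \<tau>
    using that by (simp add: gal_group_def)
  have mult: "f \<otimes>\<^bsub>gal_group E\<^esub> g = compose E f g" if "f \<in> Bij E" "g \<in> Bij E" for f g
    using that by (simp add: gal_group_def BijGroup_def)
  have inv_one: "inv\<^bsub>gal_group E\<^esub> ?id = ?id"
    unfolding m_inv_def one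
  proof (rule the_equality)
    show "?id \<in> carrier (gal_group E) \<and> ?id \<otimes>\<^bsub>gal_group E\<^esub> ?id = ?id
        \<and> ?id \<otimes>\<^bsub>gal_group E\<^esub> ?id = ?id"
      using sigma_in_carrier unfolding sigma_id
      by (simp add: mult id_Bij)
  next
    fix y
    assume y: "y \<in> carrier (gal_group E) \<and> ?id \<otimes>\<^bsub>gal_group E\<^esub> y = ?id
        \<and> y \<otimes>\<^bsub>gal_group E\<^esub> ?id = ?id"
    then have "compose E y ?id = y"
      by (metis Bij Bij_imp_extensional Bij_imp_funcset compose_Id)
    moreover have "y \<otimes>\<^bsub>gal_group E\<^esub> ?id = compose E y ?id"
      using y Bij by (intro mult id_Bij) blast
    ultimately show "y = ?id"
      using y by metis
  qed
  have "\<tau> = ?id" if "\<tau> \<in> generate (gal_group E) {\<sigma>}" for \<tau>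
    using that
  proof (induction rule: generate.induct)
    case (eng h1 h2)
    then have "h1 \<otimes>\<^bsub>gal_group E\<^esub> h2 = ?id \<otimes>\<^bsub>gal_group E\<^esub> ?id"
      by (simp only:)
    also have "\<dots> = ?id"
      by (simp add: mult id_Bij)
    finally show ?case .
  qed (use one sigma_id inv_one in auto)
  then have "\<tau> e = e" if "\<tau> \<in> generate (gal_group E) {\<sigma>}" "e \<in> E" for \<tau> e
    using that by fastforce
  then have "{e \<in> E. \<forall>\<tau>\<in>carrier (gal_group E). \<tau> e = e} = E"
    unfolding carrier_gal_group by blast
  then have "E = base_field"
    using galois_E unfolding galois_extension_def by blast
  then have "E = span {1}"
    by (simp add: base_field_def span_singleton)
  then have "dim E \<le> card {1::'a}"
    by (intro dim_le_card) auto
  with dim_E show False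
    by simp
qed

lemma sigma_sigma_a_neq: "\<sigma> (\<sigma> a) \<noteq> a" "\<sigma> (\<sigma> a) \<noteq> \<sigma> a"
  using sigma_a_neq sigma_cubed[of a] E_closed(2) by metis+

section \<open>The decomposition of the algebra over the cubic field\<close>

lemma decompose:
  obtains e0 e1 e2 where "e0 \<in> E" "e1 \<in> E" "e2 \<in> E" "s = e0 + e1 * b + e2 * b^2"
proof -
  let ?T = "{e0 + e1 * b + e2 * b^2 |e0 e1 e2. e0 \<in> E \<and> e1 \<in> E \<and> e2 \<in> E}"
  have in_T: "e0 + e1 * b + e2 * b^2 \<in> ?T" if "e0 \<in> E" "e1 \<in> E" "e2 \<in> E" for e0 e1 e2
    using that by blast
  have a2: "a^2 \<in> E"
    by (auto simp: power2_eq_square)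
  have "subspace ?T"
  proof (rule subspaceI)
    show "0 \<in> ?T"
      using in_T[of 0 0 0] by (simp add: E_closed)
  next
    fix x y assume "x \<in> ?T" "y \<in> ?T"
    then obtain e0 e1 e2 f0 f1 f2 where e: "e0 \<in> E" "e1 \<in> E" "e2 \<in> E" "f0 \<in> E" "f1 \<in> E" "f2 \<in> E"
      and xy: "x = e0 + e1 * b + e2 * b^2" "y = f0 + f1 * b + f2 * b^2"
      by blast
    have "x + y = (e0 + f0) + (e1 + f1) * b + (e2 + f2) * b^2"
      by (simp add: xy algebra_simps)
    also have "\<dots> \<in> ?T"
      using e by (intro in_T E_closed)
    finally show "x + y \<in> ?T" .
  next
    fix r x assume "x \<in> ?T"
    then obtain e0 e1 e2 where e: "e0 \<in> E" "e1 \<in> E" "e2 \<in> E" and x: "x = e0 + e1 * b + e2 * b^2"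
      by blast
    have "scale r x = scale r e0 + scale r e1 * b + scale r e2 * b^2"
      by (simp add: x scale_right_distrib scale_mult_left)
    also have "\<dots> \<in> ?T"
      using e by (intro in_T E_closed)
    finally show "scale r x \<in> ?T" .
  qed
  moreover have "{1, a, a^2, b, a * b, a^2 * b, b^2, a * b^2, a^2 * b^2} \<subseteq> ?T"
    using in_T[of 1 0 0] in_T[of a 0 0] in_T[of "a^2" 0 0]
      in_T[of 0 1 0] in_T[of 0 a 0] in_T[of 0 "a^2" 0]
      in_T[of 0 0 1] in_T[of 0 0 a] in_T[of 0 0 "a^2"] a2 E_closed(1-3)
    by simp
  ultimately have "s \<in> ?T"
    using span_minimal span_monomials by blast
  then show thesis
    using that by blast
qed

text \<open>The classical argument for independence of characters: \<open>r \<mapsto> r a - \<sigma>\<^sup>2(a) r\<close> kills the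
  \<open>b\<^sup>2\<close>-component of a relation and \<open>r \<mapsto> r a - \<sigma>(a) r\<close> its \<open>b\<close>-component, while both multiply
  the component in \<open>E\<close> by a nonzero element of \<open>E\<close>.\<close>

lemma const_component_eq_0:
  assumes e: "e0 \<in> E" "e1 \<in> E" "e2 \<in> E" and rel: "e0 + e1 * b + e2 * b^2 = 0"
  shows "e0 = 0"
proof -
  define u v where "u = a - \<sigma> (\<sigma> a)" and "v = a - \<sigma> a"
  have uv: "u \<in> E" "v \<in> E" "u \<noteq> 0" "v \<noteq> 0"
    using sigma_a_neq sigma_sigma_a_neq by (auto simp: u_def v_def)
  have ba: "b * a = \<sigma> a * b" "b^2 * a = \<sigma> (\<sigma> a) * b^2" "b * \<sigma> a = \<sigma> (\<sigma> a) * b"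
    by (auto simp: power2_eq_square b_mult mult.assoc E_closed sigma_closed)
      (simp add: b_mult E_closed sigma_closed flip: mult.assoc)
  have step1: "e0 * u + (e1 * (\<sigma> a - \<sigma> (\<sigma> a))) * b = 0"
  proof -
    have "0 = (e0 + e1 * b + e2 * b^2) * a - \<sigma> (\<sigma> a) * (e0 + e1 * b + e2 * b^2)"
      by (simp add: rel)
    also have "\<dots> = e0 * a + e1 * (b * a) + e2 * (b^2 * a)
        - (\<sigma> (\<sigma> a) * e0 + \<sigma> (\<sigma> a) * e1 * b + \<sigma> (\<sigma> a) * e2 * b^2)"
      by (simp add: algebra_simps)
    also have "\<dots> = e0 * a + e1 * (\<sigma> a * b) + e2 * (\<sigma> (\<sigma> a) * b^2)
        - (e0 * \<sigma> (\<sigma> a) + e1 * \<sigma> (\<sigma> a) * b + e2 * \<sigma> (\<sigma> a) * b^2)"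
      using e by (simp add: ba E_mult_commute[of "\<sigma> (\<sigma> a)"] E_closed sigma_closed)
    also have "\<dots> = e0 * u + (e1 * (\<sigma> a - \<sigma> (\<sigma> a))) * b"
      by (simp add: u_def algebra_simps)
    finally show ?thesis
      by simp
  qed
  let ?w = "\<sigma> a - \<sigma> (\<sigma> a)"
  have "?w \<in> E"
    by auto
  have "0 = (e0 * u + (e1 * ?w) * b) * a - \<sigma> a * (e0 * u + (e1 * ?w) * b)"
    by (simp only: step1) simp
  also have "\<dots> = e0 * u * a + (e1 * ?w) * (b * a) - (\<sigma> a * (e0 * u) + \<sigma> a * (e1 * ?w) * b)"
    by (simp add: distrib_left distrib_right mult.assoc)
  also have "\<dots> = e0 * u * a + (e1 * ?w) * (\<sigma> a * b) - (e0 * u * \<sigma> a + (e1 * ?w) * \<sigma> a * b)"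
    using e uv \<open>?w \<in> E\<close>
    by (simp only: ba E_mult_commute[of "\<sigma> a"] E_closed sigma_closed E_mult_closed)
  also have "\<dots> = e0 * u * v"
    by (simp add: v_def right_diff_distrib mult.assoc)
  finally show "e0 = 0"
    using uv E_no_zero_divisors by metis
qed

lemma components_eq_0:
  assumes e: "e0 \<in> E" "e1 \<in> E" "e2 \<in> E" and rel: "e0 + e1 * b + e2 * b^2 = 0"
  shows "e0 = 0 \<and> e1 = 0 \<and> e2 = 0"
proof -
  have e0: "e0 = 0"
    using assms by (rule const_component_eq_0)
  have b3: "b * b^2 = scale \<beta> 1" "b^2 * b^2 = scale \<beta> b"
    using b_cubed by (simp_all add: power3_eq_cube power2_eq_square mult.assoc)
      (metis mult.assoc mult_1 scale_mult_left)
  \<comment> \<open>Multiplication by \<open>b\<^sup>2\<close> rotates the components, up to the factor \<open>\<beta>\<close>.\<close>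
  have "(e1 * b + e2 * b^2) * b^2 = 0"
    using rel e0 by simp
  then have "scale \<beta> e1 + scale \<beta> e2 * b + 0 * b^2 = 0"
    by (simp only: distrib_right mult.assoc b3) (simp add: scale_mult_left scale_mult_right)
  then have "scale \<beta> e1 = 0"
    using e const_component_eq_0[of "scale \<beta> e1" "scale \<beta> e2" 0] by blast
  then have e1: "e1 = 0"
    using beta_nonzero by simp
  have "(e2 * b^2) * b = 0"
    using rel e0 e1 by simp
  then have "scale \<beta> e2 = 0"
    using b_cubed
    by (simp add: mult.assoc power2_eq_square power3_eq_cube scale_mult_right)
  then show ?thesis
    using e0 e1 beta_nonzero by simp
qed

section \<open>Coordinates on the cubic field\<close>

definition of_coords :: "'k^3 \<Rightarrow> 'a" where
  "of_coords v = scale (v $ 1) 1 + scale (v $ 2) a + scale (v $ 3) (a^2)"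

lemma of_coords_add: "of_coords (v + w) = of_coords v + of_coords w"
  by (simp add: of_coords_def scale_left_distrib)

lemma of_coords_scale: "of_coords (r *s v) = scale r (of_coords v)"
  by (simp add: of_coords_def scale_right_distrib)

lemma of_coords_diff: "of_coords (v - w) = of_coords v - of_coords w"
  by (simp add: of_coords_def scale_left_diff_distrib)

lemma of_coords_in_E [intro, simp]: "of_coords v \<in> E"
  unfolding in_E_iff of_coords_def by blast

lemma E_coords:
  assumes "x \<in> E"
  obtains v where "x = of_coords v"
proof -
  obtain r s t where "x = scale r 1 + scale s a + scale t (a^2)"
    using in_E_iff[THEN iffD1, OF assms] by blast
  then have "x = of_coords (vector [r, s, t])"
    by (simp add: of_coords_def)
  then show thesis
    by (rule that)
qed

lemma of_coords_eq_0:
  assumes "of_coords v = 0"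
  shows "v = 0"
proof -
  have dim: "dim (span {1, a, a^2}) = 3" "dim (span {a, 1, a^2}) = 3" "dim (span {a^2, 1, a}) = 3"
    using dim_E E_eq_span by (simp_all add: insert_commute)
  have rel: "scale (v $ 1) 1 + scale (v $ 2) a + scale (v $ 3) (a^2) = 0"
    "scale (v $ 2) a + scale (v $ 1) 1 + scale (v $ 3) (a^2) = 0"
    "scale (v $ 3) (a^2) + scale (v $ 1) 1 + scale (v $ 2) a = 0"
    using assms by (simp_all add: of_coords_def ac_simps)
  show ?thesis
    using dim[THEN coeff_eq_0_if_dim_span_3] rel
    by (simp add: vec_eq_iff forall_3)
qed

section \<open>From a matrix algebra to a norm equation\<close>

text \<open>The restriction to \<open>E\<close> of the module \<open>k\<^sup>3\<close> is a line over \<open>E\<close>, spanned by any nonzero \<open>v\<close>. In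
  the coordinate \<open>e \<mapsto> e v\<close> the generator \<open>b\<close> becomes \<open>e \<mapsto> \<sigma>(e) z\<close>, whose cube is multiplication
  by the norm of \<open>z\<close>.\<close>

lemma norm_eq_inverse_if_matrix_algebra_iso:
  fixes f :: "'a \<Rightarrow> 'k^3^3"
  assumes "matrix_algebra_iso f"
  shows "\<exists>x\<in>E. x * \<sigma> x * \<sigma> (\<sigma> x) = scale (1 / \<beta>) 1"
proof -
  have f_add: "f (x + y) = f x + f y" and f_scale: "f (scale r x) = (\<chi> i j. r * f x $ i $ j)"
    and f_mult: "f (x * y) = f x ** f y" and f_one: "f 1 = mat 1" for x y r
    using assms by (auto simp: matrix_algebra_iso_def Vector_Spaces.linear_iff)
  define v :: "'k^3" where "v = axis 1 1"
  define act where "act x = f x *v v" for x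
  have v: "v \<noteq> 0"
    by (simp add: v_def)
  have act_add: "act (x + y) = act x + act y" for x y
    by (simp add: act_def f_add matrix_vector_mult_add_rdistrib)
  have act_scale: "act (scale r x) = r *s act x" for r x
    by (simp add: act_def f_scale matrix_vector_mult_def vec_eq_iff sum_distrib_left mult.assoc)
  have act_mult: "act (x * y) = f x *v act y" for x y
    by (simp add: act_def f_mult matrix_vector_mul_assoc)
  have act_inj: "x = 0" if x: "x \<in> E" and "act x = 0" for x
  proof (rule ccontr)
    assume "x \<noteq> 0"
    with x obtain y where "y * x = 1"
      using E_inverse by metis
    then have "v = f y *v act x"
      by (metis act_def act_mult f_one matrix_vector_mul_lid)
    with that v show False
      by simp
  qed
  have act_diff: "act (x - y) = act x - act y" for x y
    using act_add[of "x - y" y] by simp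
  have lin: "Vector_Spaces.linear (*s) (*s) (\<lambda>w. act (of_coords w))"
    by (simp add: Vector_Spaces.linear_iff vec.vector_space_axioms of_coords_add of_coords_scale
        act_add act_scale)
  have "inj (\<lambda>w. act (of_coords w))"
  proof (rule injI)
    fix w w' assume "act (of_coords w) = act (of_coords w')"
    then have "act (of_coords (w - w')) = 0"
      by (simp add: of_coords_diff act_diff)
    then show "w = w'"
      using act_inj of_coords_eq_0 by force
  qed
  then have "surj (\<lambda>w. act (of_coords w))"
    using lin vec.linear_injective_imp_surjective by blast
  then obtain w where "act b = act (of_coords w)"
    by (metis surjD)
  then obtain z where z: "z \<in> E" and bz: "act b = act z"
    using of_coords_in_E by blast
  have b_act: "act (b * e) = act (\<sigma> e * z)" if "e \<in> E" for e
    using that by (simp add: b_mult act_mult bz)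
  let ?N = "\<sigma> (\<sigma> z) * \<sigma> z * z"
  have "act (scale \<beta> 1) = act (b * (b * b))"
    by (simp add: power3_eq_cube mult.assoc flip: b_cubed)
  also have "\<dots> = act (b * (b * z))"
    by (simp add: act_mult bz)
  also have "\<dots> = act (b * (\<sigma> z * z))"
    using z b_act by (simp add: act_mult[of b])
  also have "\<dots> = act ?N"
    using z b_act[of "\<sigma> z * z"] by (simp add: sigma_closed E_mult_closed sigma_mult mult.assoc)
  finally have "act (scale \<beta> 1 - ?N) = 0"
    by (simp add: act_diff)
  then have N: "?N = scale \<beta> 1"
    using act_inj[of "scale \<beta> 1 - ?N"] z by (simp add: E_closed E_mult_closed sigma_closed)
  have "z \<noteq> 0"
    using N beta_nonzero one_neq_zero by auto
  with z obtain x where x: "x \<in> E" and zx: "z * x = 1"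
    using E_inverse by metis
  have \<sigma>zx: "\<sigma> z * \<sigma> x = 1" "\<sigma> (\<sigma> z) * \<sigma> (\<sigma> x) = 1"
    using x z zx by (metis sigma_mult sigma_one sigma_closed)+
  have "scale \<beta> (x * \<sigma> x * \<sigma> (\<sigma> x)) = ?N * (x * \<sigma> x * \<sigma> (\<sigma> x))"
    by (simp add: N scale_mult_left)
  also have "\<dots> = \<sigma> (\<sigma> z) * (\<sigma> z * (z * x) * \<sigma> x) * \<sigma> (\<sigma> x)"
    by (simp add: mult.assoc)
  also have "\<dots> = 1"
    by (simp add: zx \<sigma>zx)
  finally have "scale (1 / \<beta>) (scale \<beta> (x * \<sigma> x * \<sigma> (\<sigma> x))) = scale (1 / \<beta>) 1"
    by simp
  then have "x * \<sigma> x * \<sigma> (\<sigma> x) = scale (1 / \<beta>) 1"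
    using beta_nonzero by simp
  with x show ?thesis
    by blast
qed

end

section \<open>From a norm equation to a matrix algebra\<close>

locale cyclic_algebra_norm_solution = cyclic_algebra_generators scale E \<sigma> \<beta> a b
  for scale :: "'k::Fields.field \<Rightarrow> 'a::Rings.ring_1 \<Rightarrow> 'a" and E \<sigma> \<beta> a b +
  fixes x :: 'a
  assumes x_in_E: "x \<in> E" and norm_x: "x * \<sigma> x * \<sigma> (\<sigma> x) = scale (1 / \<beta>) 1"
begin

definition c :: 'a where "c = x * b"

text \<open>The generator of the left ideal \<open>A p = E p\<close>; up to a scalar it is the projection onto
  the fixed space of left multiplication by \<open>c\<close> whenever \<open>3\<close> is invertible.\<close>

definition p :: 'a where "p = 1 + c + c * c"

lemma c_mult: "e \<in> E \<Longrightarrow> c * e = \<sigma> e * c"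
  using b_mult[of e] E_mult_commute[of x "\<sigma> e"] x_in_E
  by (simp add: c_def mult.assoc sigma_closed) (simp add: sigma_closed flip: mult.assoc)

lemma c_squared: "c * c = x * \<sigma> x * b^2"
  using b_mult[OF x_in_E] unfolding c_def power2_eq_square by (metis mult.assoc)

lemma c_cubed: "c * (c * c) = 1"
proof -
  have "c * (c * c) = x * (b * (x * \<sigma> x)) * b^2"
    by (simp add: c_squared) (simp add: c_def mult.assoc)
  also have "\<dots> = x * \<sigma> x * \<sigma> (\<sigma> x) * b^3"
    using x_in_E by (simp add: b_mult sigma_mult E_mult_closed sigma_closed mult.assoc
        power2_eq_square power3_eq_cube)
  finally show ?thesis
    using beta_nonzero by (simp add: norm_x b_cubed scale_mult_left)
qed

lemma c_mult_p: "c * p = p"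
  by (simp add: p_def distrib_left c_cubed add_ac)

lemma x_nonzero: "x \<noteq> 0"
  using norm_x beta_nonzero one_neq_zero by auto

lemma E_mult_p_eq_0:
  assumes "y \<in> E" "y * p = 0"
  shows "y = 0"
proof -
  have "y + (y * x) * b + (y * (x * \<sigma> x)) * b^2 = 0"
    using assms(2) by (simp add: p_def c_squared distrib_left mult.assoc) (simp add: c_def)
  then show ?thesis
    using assms(1) x_in_E components_eq_0[of y "y * x" "y * (x * \<sigma> x)"]
    by (simp add: E_mult_closed sigma_closed)
qed

text \<open>As \<open>c p = p\<close>, the generator \<open>b\<close> acts on \<open>p\<close> like the inverse \<open>z\<close> of \<open>x\<close>.\<close>

lemma left_ideal_eq: "\<exists>v. t * p = of_coords v * p"
proof -
  obtain z where z: "z \<in> E" "z * x = 1"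
    using E_inverse[OF x_in_E x_nonzero] by metis
  have bp: "b * p = z * p"
    by (metis c_def c_mult_p mult.assoc mult_1 z(2))
  have b2p: "b^2 * p = \<sigma> z * z * p"
    by (metis b_mult bp mult.assoc power2_eq_square z(1))
  obtain e0 e1 e2 where e: "e0 \<in> E" "e1 \<in> E" "e2 \<in> E" and t: "t = e0 + e1 * b + e2 * b^2"
    by (rule decompose)
  have "t * p = (e0 + e1 * z + e2 * (\<sigma> z * z)) * p"
    by (simp add: t distrib_right mult.assoc bp b2p)
  moreover have "e0 + e1 * z + e2 * (\<sigma> z * z) \<in> E"
    using e z by auto
  ultimately show ?thesis
    using E_coords by metis
qed

lemma of_coords_mult_p_inj: "of_coords v * p = of_coords w * p \<Longrightarrow> v = w"
  using E_mult_p_eq_0[of "of_coords (v - w)"] of_coords_eq_0[of "v - w"]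
  by (simp add: of_coords_diff left_diff_distrib E_closed)

definition act_coords :: "'a \<Rightarrow> 'k^3 \<Rightarrow> 'k^3" where
  "act_coords s v = (THE w. s * of_coords v * p = of_coords w * p)"

lemma act_coords_eqI: "s * of_coords v * p = of_coords w * p \<Longrightarrow> act_coords s v = w"
  unfolding act_coords_def by (rule the_equality) (auto intro: of_coords_mult_p_inj)

lemma of_coords_act_coords: "of_coords (act_coords s v) * p = s * of_coords v * p"
  using left_ideal_eq act_coords_eqI by metis

definition left_mult_matrix :: "'a \<Rightarrow> 'k^3^3" where
  "left_mult_matrix s = matrix (act_coords s)"

lemma left_mult_matrix_works: "left_mult_matrix s *v v = act_coords s v"
proof -
  have "Vector_Spaces.linear (*s) (*s) (act_coords s)"
    by (auto simp: Vector_Spaces.linear_iff vec.vector_space_axioms of_coords_add of_coords_scale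
        distrib_left distrib_right scale_mult_left scale_mult_right of_coords_act_coords
        intro!: act_coords_eqI)
  then show ?thesis
    unfolding left_mult_matrix_def by (rule matrix_works)
qed

lemma left_mult_matrix_eqI:
  assumes "\<And>v. s * of_coords v * p = of_coords (M *v v) * p"
  shows "left_mult_matrix s = M"
  using assms by (simp add: matrix_eq left_mult_matrix_works act_coords_eqI)

lemma left_mult_matrix_add: "left_mult_matrix (s + t) = left_mult_matrix s + left_mult_matrix t"
  by (rule left_mult_matrix_eqI)
    (simp add: matrix_vector_mult_add_rdistrib left_mult_matrix_works of_coords_add distrib_right
      of_coords_act_coords)

lemma left_mult_matrix_scale:
  "left_mult_matrix (scale r s) = (\<chi> i j. r * left_mult_matrix s $ i $ j)"
proof (rule left_mult_matrix_eqI)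
  fix v
  have "(\<chi> i j. r * left_mult_matrix s $ i $ j) *v v = r *s (left_mult_matrix s *v v)"
    by (simp add: matrix_vector_mult_def vec_eq_iff sum_distrib_left mult.assoc)
  then show "scale r s * of_coords v * p
      = of_coords ((\<chi> i j. r * left_mult_matrix s $ i $ j) *v v) * p"
    by (simp add: left_mult_matrix_works of_coords_scale of_coords_act_coords scale_mult_left)
qed

lemma left_mult_matrix_mult: "left_mult_matrix (s * t) = left_mult_matrix s ** left_mult_matrix t"
proof (rule left_mult_matrix_eqI)
  fix v
  have "of_coords ((left_mult_matrix s ** left_mult_matrix t) *v v) * p
      = s * of_coords (act_coords t v) * p"
    by (simp add: left_mult_matrix_works of_coords_act_coords flip: matrix_vector_mul_assoc)
  then show "s * t * of_coords v * p
      = of_coords ((left_mult_matrix s ** left_mult_matrix t) *v v) * p"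
    by (simp add: mult.assoc of_coords_act_coords)
qed

lemma left_mult_matrix_one: "left_mult_matrix 1 = mat 1"
  by (rule left_mult_matrix_eqI) simp

text \<open>Instead of invoking simplicity of \<open>A\<close>, one exhibits a unit in the two-sided ideal
  generated by \<open>p\<close>: taking commutators of \<open>p\<close> with \<open>a\<close>, twisted by \<open>\<sigma>\<close> and then by \<open>\<sigma>\<^sup>2\<close>,
  removes the components at \<open>c\<close> and \<open>c\<^sup>2\<close> and leaves \<open>(a - \<sigma>(a)) (a - \<sigma>\<^sup>2(a)) \<noteq> 0\<close>.\<close>

lemma eq_0_if_annihilates_E_p:
  assumes ann: "\<And>y. y \<in> E \<Longrightarrow> s * (y * p) = 0"
  shows "s = 0"
proof -
  define a' a'' where "a' = \<sigma> a" and "a'' = \<sigma> (\<sigma> a)"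
  have E: "a \<in> E" "a' \<in> E" "a'' \<in> E"
    by (auto simp: a'_def a''_def)
  have ca: "c * a = a' * c" "c * a' = a'' * c"
    using c_mult E by (auto simp: a'_def a''_def)
  then have cca: "c * (c * a) = a'' * (c * c)" "c * (a' * c) = a'' * (c * c)"
    by (metis mult.assoc)+
  define q where "q = p * a - a' * p"
  have q: "q = (a - a') + (a'' - a') * (c * c)"
    by (simp add: q_def p_def algebra_simps ca cca)
  have "q * a - a'' * q
      = (a - a') * a - a'' * (a - a') + ((a'' - a') * a'' - a'' * (a'' - a')) * (c * c)"
    unfolding q by (simp add: distrib_left distrib_right left_diff_distrib mult.assoc cca)
  also have "\<dots> = (a - a') * (a - a'')"
    using E_mult_commute[of a'' "a - a'"] E_mult_commute[of a'' "a'' - a'"] E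
    by (simp add: E_closed right_diff_distrib)
  finally have key: "q * a - a'' * q = (a - a') * (a - a'')" .
  have s_E_p: "s * y * p = 0" if "y \<in> E" for y
    using ann that by (simp add: mult.assoc)
  have "s * q = s * 1 * p * a - s * a' * p"
    by (simp add: q_def right_diff_distrib mult.assoc)
  then have "s * q = 0"
    using s_E_p[of 1] s_E_p[of a'] E by (simp add: E_closed)
  moreover have "s * a'' * q = s * a'' * p * a - s * (a'' * a') * p"
    by (simp add: q_def right_diff_distrib mult.assoc)
  then have "s * a'' * q = 0"
    using s_E_p[of "a''"] s_E_p[of "a'' * a'"] E by (simp add: E_mult_closed)
  moreover have "s * ((a - a') * (a - a'')) = s * q * a - s * a'' * q"
    unfolding key[symmetric] by (simp only: right_diff_distrib mult.assoc)
  ultimately have "s * (a - a') * (a - a'') = 0"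
    by (simp add: mult.assoc)
  moreover have "a - a' \<in> E" "a - a'' \<in> E" "a - a' \<noteq> 0" "a - a'' \<noteq> 0"
    using E sigma_a_neq sigma_sigma_a_neq by (simp_all add: E_closed) (simp_all add: a'_def a''_def)
  ultimately show "s = 0"
    by (meson E_no_zero_divisors)
qed

lemma left_mult_matrix_eq_0:
  assumes "left_mult_matrix s = 0"
  shows "s = 0"
proof (rule eq_0_if_annihilates_E_p)
  fix y assume "y \<in> E"
  then obtain v where "y = of_coords v"
    by (rule E_coords)
  moreover have "act_coords s v = 0"
    using left_mult_matrix_works[of s v] assms by simp
  ultimately show "s * (y * p) = 0"
    using of_coords_act_coords[of s v] by (simp add: of_coords_def mult.assoc)
qed

lemma linear_left_mult_matrix:
  "Vector_Spaces.linear scale (\<lambda>r M. \<chi> i j. r * M $ i $ j) left_mult_matrix"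
proof -
  have "vector_space (\<lambda>r (M::'k^3^3). \<chi> i j. r * M $ i $ j)"
    by unfold_locales (simp_all add: vec_eq_iff algebra_simps)
  then show ?thesis
    by (simp add: Vector_Spaces.linear_iff vector_space_axioms left_mult_matrix_add
        left_mult_matrix_scale)
qed

lemma inj_left_mult_matrix: "inj left_mult_matrix"
proof -
  interpret L: Vector_Spaces.linear scale "\<lambda>r M. \<chi> i j. r * M $ i $ j" left_mult_matrix
    by (rule linear_left_mult_matrix)
  show ?thesis
    using left_mult_matrix_eq_0 by (simp add: L.inj_iff_eq_0)
qed

text \<open>Reading the rows of a matrix as the components at \<open>1, b, b\<^sup>2\<close> gives an injective linear map
  back to \<open>A\<close>. Its composite with the representation is an injective endomorphism of the
  finite-dimensional space \<open>A\<close>, hence surjective.\<close>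

lemma surj_left_mult_matrix: "surj left_mult_matrix"
proof -
  define h :: "'k^3^3 \<Rightarrow> 'a"
    where "h M = of_coords (M $ 1) + of_coords (M $ 2) * b + of_coords (M $ 3) * b^2" for M
  have h_inj: "M = M'" if "h M = h M'" for M M'
  proof -
    have "of_coords (M $ 1 - M' $ 1) + of_coords (M $ 2 - M' $ 2) * b
        + of_coords (M $ 3 - M' $ 3) * b^2 = 0"
      using that by (simp add: h_def of_coords_diff algebra_simps)
    from components_eq_0[OF _ _ _ this]
    have "\<forall>i. M $ i - M' $ i = 0"
      unfolding forall_3 using of_coords_eq_0 by blast
    then show ?thesis
      by (subst vec_eq_iff) simp
  qed
  have h_add: "h (M + M') = h M + h M'" for M M'
    by (simp add: h_def of_coords_add distrib_right add_ac)
  have h_scale: "h (\<chi> i j. r * M $ i $ j) = scale r (h M)" for r M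
  proof -
    have "(\<chi> i j. r * M $ i $ j) $ i = r *s M $ i" for i
      by (simp add: vec_eq_iff)
    then show ?thesis
      by (simp only: h_def of_coords_scale scale_right_distrib scale_mult_left)
  qed
  obtain B where B: "B \<subseteq> {1, a, a^2, b, a * b, a^2 * b, b^2, a * b^2, a^2 * b^2}"
    "independent B" "{1, a, a^2, b, a * b, a^2 * b, b^2, a * b^2, a^2 * b^2} \<subseteq> span B"
    by (rule maximal_independent_subset)
  have "span B = UNIV"
    using span_minimal[OF B(3)] span_monomials by auto
  moreover have "finite B"
    using B(1) by (rule finite_subset) simp
  ultimately interpret fd: finite_dimensional_vector_space scale B
    using B(2) by unfold_locales auto
  have "Vector_Spaces.linear scale scale (\<lambda>s. h (left_mult_matrix s))"
    by (simp add: Vector_Spaces.linear_iff vector_space_axioms left_mult_matrix_add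
        left_mult_matrix_scale h_add h_scale)
  moreover have "inj (\<lambda>s. h (left_mult_matrix s))"
    using h_inj inj_left_mult_matrix by (auto simp: inj_def)
  ultimately have "surj (\<lambda>s. h (left_mult_matrix s))"
    by (rule fd.linear_inj_imp_surj)
  then show ?thesis
    unfolding surj_def using h_inj by metis
qed

lemma matrix_algebra_iso_left_mult_matrix: "matrix_algebra_iso left_mult_matrix"
  by (simp add: matrix_algebra_iso_def linear_left_mult_matrix bij_def inj_left_mult_matrix
      surj_left_mult_matrix left_mult_matrix_mult left_mult_matrix_one)

end

section \<open>The splitting criterion\<close>

theorem theorem5p8:
  fixes scale :: "rat \<Rightarrow> 'a::Rings.ring_1 \<Rightarrow> 'a"
    and E :: "'a set" and \<sigma> :: "'a \<Rightarrow> 'a" and \<beta> :: rat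
  assumes "unital_algebra scale"
    and "unital_algebra.cyclic_algebra_deg3 scale E \<sigma> \<beta>"
  shows "(\<exists>f :: 'a \<Rightarrow> rat^3^3. unital_algebra.matrix_algebra_iso scale f) \<longleftrightarrow>
         (\<exists>x\<in>E. x * \<sigma> x * \<sigma> (\<sigma> x) = scale (1 / \<beta>) 1)"
proof -
  interpret unital_algebra scale
    by (rule assms(1))
  obtain a b where "cyclic_algebra_generators scale E \<sigma> \<beta> a b"
    using assms unfolding cyclic_algebra_deg3_def cyclic_algebra_generators_def
      cyclic_algebra_generators_axioms_def by blast
  then interpret cyclic_algebra_generators scale E \<sigma> \<beta> a b .
  show ?thesis
  proof
    assume "\<exists>f :: 'a \<Rightarrow> rat^3^3. matrix_algebra_iso f"
    then show "\<exists>x\<in>E. x * \<sigma> x * \<sigma> (\<sigma> x) = scale (1 / \<beta>) 1"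
      using norm_eq_inverse_if_matrix_algebra_iso by blast
  next
    assume "\<exists>x\<in>E. x * \<sigma> x * \<sigma> (\<sigma> x) = scale (1 / \<beta>) 1"
    then obtain x where "x \<in> E" "x * \<sigma> x * \<sigma> (\<sigma> x) = scale (1 / \<beta>) 1"
      by blast
    then interpret cyclic_algebra_norm_solution scale E \<sigma> \<beta> a b x
      by unfold_locales
    show "\<exists>f :: 'a \<Rightarrow> rat^3^3. matrix_algebra_iso f"
      using matrix_algebra_iso_left_mult_matrix by blast
  qed
qed

end
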